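(* Let $k$ be a field, $G$ a finite group, $A$ and $B$ associative $k$-algebras with actions $(G,A)$ and $(G,B)$, and $\phi:A\to B$ a $G$-equivariant associative algebra morphism. Let $n\ge 1$ and let $(\mu_t,\nu_t,\phi_t)$ be an equivariant deformation of $\phi$ of order $n$. Then the $(n+1)$th obstruction cochain $Ob_{n+1}(\phi_t)\in C_G^3(\phi,\phi)$ is a 3-cocycle, i.e. $d^3(Ob_{n+1}(\phi_t))=0$.
   Context: An associative $k$-algebra is a $k$-vector space with an associative $k$-bilinear product (no unit is required); an associative algebra morphism is a $k$-linear multiplicative map. An action $(G,A)$ is a left action of $G$ on the set $A$ such that each $a\mapsto ga$ is $k$-linear and $(ga)(gb)=g(ab)$. A $G$-equivariant associative algebra morphism $\phi:A\to B$ is an associative algebra morphism with $\phi(ga)=g\phi(a)$ for all $g\in G$, $a\in A$. For an $A$-bimodule $M$ with compatible linear $G$-action, $C_G^n(A;M)$ ($n\ge 0$) is the space of $f\in\mathrm{Hom}_k(A^{\otimes n},M)$ with $f(gx_1,\dots,gx_n)=g f(x_1,\dots,x_n)$ for all $g\in G$, with the Hochschild coboundary $$\delta^n f(x_1,\dots,x_{n+1})=x_1f(x_2,\dots,x_{n+1})+\sum_{i=1}^n(-1)^if(x_1,\dots,x_ix_{i+1},\dots,x_{n+1})+(-1)^{n+1}f(x_1,\dots,x_n)x_{n+1}.$$ $B$ is an $A$-bimodule via $\phi$. The equivariant deformation complex of $\phi$ is $C_G^0(\phi,\phi)=0$ and, for $n\ge 1$, $C_G^n(\phi,\phi)=C_G^n(A;A)\oplus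 C_G^n(B;B)\oplus C_G^{n-1}(A;B)$, with $d^0=0$ and $d^n(u,v,w)=(\delta^nu,\delta^nv,\phi u-v\phi-\delta^{n-1}w)$, where $\phi u=\phi\circ u$ and $v\phi(x_1,\dots,x_n)=v(\phi(x_1),\dots,\phi(x_n))$. An equivariant deformation of $\phi$ of order $n$ is a triple $(\mu_t,\nu_t,\phi_t)$ with $\mu_t=\sum_{i=0}^n\mu_it^i$, $\nu_t=\sum_{i=0}^n\nu_it^i$, $\phi_t=\sum_{i=0}^n\phi_it^i$, where $\mu_i:A\times A\to A$ and $\nu_i:B\times B\to B$ are $k$-bilinear, $\phi_i:A\to B$ are $k$-linear, $\mu_0$ and $\nu_0$ are the given products, $\phi_0=\phi$, all $\mu_i,\nu_i,\phi_i$ are $G$-equivariant ($\mu_i(ga,gb)=g\mu_i(a,b)$, $\nu_i(gx,gy)=g\nu_i(x,y)$, $\phi_i(ga)=g\phi_i(a)$), and for all $0\le r\le n$: $$\sum_{i+j=r}\mu_i(\mu_j(a,b),c)=\sum_{i+j=r}\mu_i(a,\mu_j(b,c))\quad (a,b,c\in A),$$ $$\sum_{i+j=r}\nu_i(\nu_j(a,b),c)=\sum_{i+j=r}\nu_i(a,\nu_j(b,c))\quad (a,b,c\in B),$$ $$\sum_{i+j=r}\phi_i(\mu_j(a,b))=\sum_{i+j+k=r}\nu_i(\phi_j(a),\phi_k(b))\quad (a,b\in A).$$ The $(n+1)$th obstruction cochain is $Ob_{n+1}(\phi_t)=(O_1,O_2,O_3)$, where for $a,b,c,p,q\in A$ and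 $x,y,z\in B$ $$O_1(a,b,c)=\sum_{\substack{i+j=n+1\\ i,j>0}}\{\mu_i(\mu_j(a,b),c)-\mu_i(a,\mu_j(b,c))\},$$ $$O_2(x,y,z)=\sum_{\substack{i+j=n+1\\ i,j>0}}\{\nu_i(\nu_j(x,y),z)-\nu_i(x,\nu_j(y,z))\},$$ $$O_3(p,q)=\sum{}^{\prime}\,\nu_i(\phi_j(p),\phi_k(q))-\sum_{\substack{i+j=n+1\\ i,j>0}}\phi_i(\mu_j(p,q)),$$ and $\sum'$ is the sum over all triples $(i,j,k)$ of nonnegative integers with $i+j+k=n+1$ in which at least two of $i,j,k$ are positive. *)

theory Defs
  imports "HOL-Algebra.Group_Action" "HOL.Vector_Spaces"
begin

(* An algebra is carried by a whole type of class ab_group_add, with the scalar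
   multiplication s of the library locale vector_space and a product m (no unit). *)

definition bilinear_op :: "('k::field \<Rightarrow> 'a::ab_group_add \<Rightarrow> 'a) \<Rightarrow> ('a \<Rightarrow> 'a \<Rightarrow> 'a) \<Rightarrow> bool" where
  "bilinear_op s m \<longleftrightarrow>
     (\<forall>x. Vector_Spaces.linear s s (\<lambda>y. m x y)) \<and> (\<forall>y. Vector_Spaces.linear s s (\<lambda>x. m x y))"

locale assoc_alg = vector_space s
  for s :: "'k::field \<Rightarrow> 'a::ab_group_add \<Rightarrow> 'a" +
  fixes m :: "'a \<Rightarrow> 'a \<Rightarrow> 'a"
  assumes bilinear: "bilinear_op s m"
    and assoc: "m (m a b) c = m a (m b c)"

locale equivariant_alg = assoc_alg s m + group_action G UNIV act
  for G :: "('g, 'z) monoid_scheme" (structure)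
    and s :: "'k::field \<Rightarrow> 'a::ab_group_add \<Rightarrow> 'a"
    and m :: "'a \<Rightarrow> 'a \<Rightarrow> 'a"
    and act :: "'g \<Rightarrow> 'a \<Rightarrow> 'a" +
  assumes act_linear: "g \<in> carrier G \<Longrightarrow> Vector_Spaces.linear s s (act g)"
    and act_mult: "g \<in> carrier G \<Longrightarrow> m (act g a) (act g b) = act g (m a b)"

definition equivariant_map ::
  "('g, 'z) monoid_scheme \<Rightarrow> ('g \<Rightarrow> 'a \<Rightarrow> 'a) \<Rightarrow> ('g \<Rightarrow> 'b \<Rightarrow> 'b) \<Rightarrow> ('a \<Rightarrow> 'b) \<Rightarrow> bool" where
  "equivariant_map G actA actB f \<longleftrightarrow> (\<forall>g\<in>carrier G. \<forall>a. f (actA g a) = actB g (f a))"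

definition equivariant_op ::
  "('g, 'z) monoid_scheme \<Rightarrow> ('g \<Rightarrow> 'a \<Rightarrow> 'a) \<Rightarrow> ('a \<Rightarrow> 'a \<Rightarrow> 'a) \<Rightarrow> bool" where
  "equivariant_op G act m \<longleftrightarrow>
     (\<forall>g\<in>carrier G. \<forall>a b. m (act g a) (act g b) = act g (m a b))"

definition equivariant_alg_morphism ::
  "('g, 'z) monoid_scheme \<Rightarrow>
   ('k::field \<Rightarrow> 'a::ab_group_add \<Rightarrow> 'a) \<Rightarrow> ('a \<Rightarrow> 'a \<Rightarrow> 'a) \<Rightarrow> ('g \<Rightarrow> 'a \<Rightarrow> 'a) \<Rightarrow>
   ('k \<Rightarrow> 'b::ab_group_add \<Rightarrow> 'b) \<Rightarrow> ('b \<Rightarrow> 'b \<Rightarrow> 'b) \<Rightarrow> ('g \<Rightarrow> 'b \<Rightarrow> 'b) \<Rightarrow>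
   ('a \<Rightarrow> 'b) \<Rightarrow> bool" where
  "equivariant_alg_morphism G sA mA actA sB mB actB \<phi> \<longleftrightarrow>
     Vector_Spaces.linear sA sB \<phi> \<and> (\<forall>a b. \<phi> (mA a b) = mB (\<phi> a) (\<phi> b)) \<and>
     equivariant_map G actA actB \<phi>"

(* C_G^n(A;M). A linear map on the n-th tensor power is given as an n-fold multilinear
   function on lists of length n. It is set to 0 on lists of any other length, so that
   equality of cochains is equality of functions. *)
definition cochains ::
  "('g, 'z) monoid_scheme \<Rightarrow>
   ('k::field \<Rightarrow> 'a::ab_group_add \<Rightarrow> 'a) \<Rightarrow> ('g \<Rightarrow> 'a \<Rightarrow> 'a) \<Rightarrow>
   ('k \<Rightarrow> 'm::ab_group_add \<Rightarrow> 'm) \<Rightarrow> ('g \<Rightarrow> 'm \<Rightarrow> 'm) \<Rightarrow>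
   nat \<Rightarrow> ('a list \<Rightarrow> 'm) set" where
  "cochains G sA actA sM actM n = {f.
     (\<forall>xs. length xs \<noteq> n \<longrightarrow> f xs = 0) \<and>
     (\<forall>xs i. length xs = n \<longrightarrow> i < n \<longrightarrow> Vector_Spaces.linear sA sM (\<lambda>x. f (xs[i := x]))) \<and>
     (\<forall>g\<in>carrier G. \<forall>xs. length xs = n \<longrightarrow> f (map (actA g) xs) = actM g (f xs))}"

(* The coboundary of an n-cochain with values in a bimodule with left action lact and right
   action ract. List positions start at 0, so x_i is xs ! (i - 1). *)
definition hochschild ::
  "('k::field \<Rightarrow> 'm::ab_group_add \<Rightarrow> 'm) \<Rightarrow> ('a \<Rightarrow> 'a \<Rightarrow> 'a) \<Rightarrow> ('a \<Rightarrow> 'm \<Rightarrow> 'm) \<Rightarrow> ('m \<Rightarrow> 'a \<Rightarrow> 'm) \<Rightarrow>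
   nat \<Rightarrow> ('a list \<Rightarrow> 'm) \<Rightarrow> 'a list \<Rightarrow> 'm" where
  "hochschild sM mA lact ract n f xs =
     (if length xs = n + 1 then
        lact (hd xs) (f (tl xs))
        + (\<Sum>i = 1..n. sM ((- 1) ^ i)
             (f (take (i - 1) xs @ [mA (xs ! (i - 1)) (xs ! i)] @ drop (i + 1) xs)))
        + sM ((- 1) ^ (n + 1)) (ract (f (butlast xs)) (last xs))
      else 0)"

definition deformation_cochains ::
  "('g, 'z) monoid_scheme \<Rightarrow>
   ('k::field \<Rightarrow> 'a::ab_group_add \<Rightarrow> 'a) \<Rightarrow> ('g \<Rightarrow> 'a \<Rightarrow> 'a) \<Rightarrow>
   ('k \<Rightarrow> 'b::ab_group_add \<Rightarrow> 'b) \<Rightarrow> ('g \<Rightarrow> 'b \<Rightarrow> 'b) \<Rightarrow>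
   nat \<Rightarrow> (('a list \<Rightarrow> 'a) \<times> ('b list \<Rightarrow> 'b) \<times> ('a list \<Rightarrow> 'b)) set" where
  "deformation_cochains G sA actA sB actB n =
     (if n = 0 then {(\<lambda>_. 0, \<lambda>_. 0, \<lambda>_. 0)}
      else cochains G sA actA sA actA n \<times> cochains G sB actB sB actB n
             \<times> cochains G sA actA sB actB (n - 1))"

fun deformation_d ::
  "('k::field \<Rightarrow> 'a::ab_group_add \<Rightarrow> 'a) \<Rightarrow> ('a \<Rightarrow> 'a \<Rightarrow> 'a) \<Rightarrow>
   ('k \<Rightarrow> 'b::ab_group_add \<Rightarrow> 'b) \<Rightarrow> ('b \<Rightarrow> 'b \<Rightarrow> 'b) \<Rightarrow> ('a \<Rightarrow> 'b) \<Rightarrow> nat \<Rightarrow>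
   ('a list \<Rightarrow> 'a) \<times> ('b list \<Rightarrow> 'b) \<times> ('a list \<Rightarrow> 'b) \<Rightarrow>
   ('a list \<Rightarrow> 'a) \<times> ('b list \<Rightarrow> 'b) \<times> ('a list \<Rightarrow> 'b)" where
  "deformation_d sA mA sB mB \<phi> n (u, v, w) =
     (if n = 0 then (\<lambda>_. 0, \<lambda>_. 0, \<lambda>_. 0)
      else (hochschild sA mA mA mA n u,
            hochschild sB mB mB mB n v,
            \<lambda>xs. \<phi> (u xs) - v (map \<phi> xs)
                 - hochschild sB mA (\<lambda>a b. mB (\<phi> a) b) (\<lambda>b a. mB b (\<phi> a)) (n - 1) w xs))"

(* A polynomial in t of degree at most n is given by its sequence of coefficients; only the
   coefficients with index at most n are used, here and in the obstruction. *)
definition equivariant_deformation ::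
  "('g, 'z) monoid_scheme \<Rightarrow>
   ('k::field \<Rightarrow> 'a::ab_group_add \<Rightarrow> 'a) \<Rightarrow> ('a \<Rightarrow> 'a \<Rightarrow> 'a) \<Rightarrow> ('g \<Rightarrow> 'a \<Rightarrow> 'a) \<Rightarrow>
   ('k \<Rightarrow> 'b::ab_group_add \<Rightarrow> 'b) \<Rightarrow> ('b \<Rightarrow> 'b \<Rightarrow> 'b) \<Rightarrow> ('g \<Rightarrow> 'b \<Rightarrow> 'b) \<Rightarrow>
   ('a \<Rightarrow> 'b) \<Rightarrow> nat \<Rightarrow>
   (nat \<Rightarrow> 'a \<Rightarrow> 'a \<Rightarrow> 'a) \<Rightarrow> (nat \<Rightarrow> 'b \<Rightarrow> 'b \<Rightarrow> 'b) \<Rightarrow> (nat \<Rightarrow> 'a \<Rightarrow> 'b) \<Rightarrow> bool" where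
  "equivariant_deformation G sA mA actA sB mB actB \<phi> n \<mu> \<nu> \<phi>t \<longleftrightarrow>
     \<mu> 0 = mA \<and> \<nu> 0 = mB \<and> \<phi>t 0 = \<phi> \<and>
     (\<forall>i\<le>n. bilinear_op sA (\<mu> i) \<and> equivariant_op G actA (\<mu> i)) \<and>
     (\<forall>i\<le>n. bilinear_op sB (\<nu> i) \<and> equivariant_op G actB (\<nu> i)) \<and>
     (\<forall>i\<le>n. Vector_Spaces.linear sA sB (\<phi>t i) \<and> equivariant_map G actA actB (\<phi>t i)) \<and>
     (\<forall>r\<le>n. \<forall>a b c.
        (\<Sum>(i, j)\<in>{(i, j). i + j = r}. \<mu> i (\<mu> j a b) c)
        = (\<Sum>(i, j)\<in>{(i, j). i + j = r}. \<mu> i a (\<mu> j b c))) \<and>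
     (\<forall>r\<le>n. \<forall>a b c.
        (\<Sum>(i, j)\<in>{(i, j). i + j = r}. \<nu> i (\<nu> j a b) c)
        = (\<Sum>(i, j)\<in>{(i, j). i + j = r}. \<nu> i a (\<nu> j b c))) \<and>
     (\<forall>r\<le>n. \<forall>a b.
        (\<Sum>(i, j)\<in>{(i, j). i + j = r}. \<phi>t i (\<mu> j a b))
        = (\<Sum>(i, j, k)\<in>{(i, j, k). i + j + k = r}. \<nu> i (\<phi>t j a) (\<phi>t k b)))"

definition associator_obstruction ::
  "nat \<Rightarrow> (nat \<Rightarrow> 'a \<Rightarrow> 'a \<Rightarrow> 'a::ab_group_add) \<Rightarrow> 'a list \<Rightarrow> 'a" where
  "associator_obstruction n \<mu> xs =
     (case xs of
        [a, b, c] \<Rightarrow> (\<Sum>(i, j)\<in>{(i, j). i + j = n + 1 \<and> 0 < i \<and> 0 < j}.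
                        \<mu> i (\<mu> j a b) c - \<mu> i a (\<mu> j b c))
      | _ \<Rightarrow> 0)"

definition morphism_obstruction ::
  "nat \<Rightarrow> (nat \<Rightarrow> 'a \<Rightarrow> 'a \<Rightarrow> 'a) \<Rightarrow> (nat \<Rightarrow> 'b \<Rightarrow> 'b \<Rightarrow> 'b::ab_group_add) \<Rightarrow> (nat \<Rightarrow> 'a \<Rightarrow> 'b) \<Rightarrow>
   'a list \<Rightarrow> 'b" where
  "morphism_obstruction n \<mu> \<nu> \<phi>t xs =
     (case xs of
        [p, q] \<Rightarrow>
          (\<Sum>(i, j, k)\<in>{(i, j, k). i + j + k = n + 1 \<and>
                          (0 < i \<and> 0 < j \<or> 0 < i \<and> 0 < k \<or> 0 < j \<and> 0 < k)}.
             \<nu> i (\<phi>t j p) (\<phi>t k q))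
          - (\<Sum>(i, j)\<in>{(i, j). i + j = n + 1 \<and> 0 < i \<and> 0 < j}. \<phi>t i (\<mu> j p q))
      | _ \<Rightarrow> 0)"

(* The (n+1)th obstruction cochain of a deformation of order n. *)
definition obstruction ::
  "nat \<Rightarrow> (nat \<Rightarrow> 'a \<Rightarrow> 'a \<Rightarrow> 'a::ab_group_add) \<Rightarrow> (nat \<Rightarrow> 'b \<Rightarrow> 'b \<Rightarrow> 'b::ab_group_add) \<Rightarrow>
   (nat \<Rightarrow> 'a \<Rightarrow> 'b) \<Rightarrow> ('a list \<Rightarrow> 'a) \<times> ('b list \<Rightarrow> 'b) \<times> ('a list \<Rightarrow> 'b)" where
  "obstruction n \<mu> \<nu> \<phi>t =
     (associator_obstruction n \<mu>, associator_obstruction n \<nu>, morphism_obstruction n \<mu> \<nu> \<phi>t)"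

end

theory Submission
  imports Defs "HOL-Computational_Algebra.Formal_Power_Series"
begin

text \<open>
  Extend the coefficients of the deformation by zero beyond degree \<open>n\<close>. They then define products
  \<open>\<mu>\<close>, \<open>\<nu>\<close> and a map \<open>\<phi>\<close> on the formal power series over \<open>A\<close> and \<open>B\<close>, all additive and compatible
  with multiplication by \<open>t\<close>. Two errors measure the failure of these extensions:
  the associator \<open>F\<^sub>\<mu>(a,b,c) = \<mu>(\<mu>(a,b),c) - \<mu>(a,\<mu>(b,c))\<close> (likewise \<open>F\<^sub>\<nu>\<close>) and the defect
  \<open>H(a,b) = \<nu>(\<phi> a,\<phi> b) - \<phi>(\<mu>(a,b))\<close>. The deformation equations say that on constant series both
  errors are divisible by \<open>t^(n+1)\<close>; since the extensions are \<open>t\<close>-linear, this holds on all series.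
  The coefficients of the errors in degree \<open>n+1\<close> are exactly the components of the obstruction: a
  summand of the full convolution that is missing from the obstruction involves a coefficient of
  index \<open>n+1\<close>, which was set to zero.

  For arbitrary biadditive products and an additive map, whether associative and multiplicative or
  not, cancellation of terms gives the two identities
    \<^item> \<open>\<mu>(a,F(b,c,d)) - F(\<mu>(a,b),c,d) + F(a,\<mu>(b,c),d) - F(a,b,\<mu>(c,d)) + \<mu>(F(a,b,c),d) = 0\<close>,
    \<^item> \<open>\<phi>(F\<^sub>\<mu>(a,b,c)) - F\<^sub>\<nu>(\<phi> a,\<phi> b,\<phi> c) = \<nu>(\<phi> a,H(b,c)) - H(\<mu>(a,b),c) + H(a,\<mu>(b,c)) - \<nu>(H(a,b),\<phi> c)\<close>
  (\<open>associator_cocycle\<close> and \<open>morphism_defect_coboundary\<close>). Apply them to the power series structures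
  and compare coefficients of \<open>t^(n+1)\<close>. As every error starts in degree \<open>n+1\<close>, all other factors
  contribute only their constant terms, which are the given products and the given morphism. What
  remains are the three components of the cocycle condition (\<open>associator_coeff_cocycle\<close> and
  \<open>defect_coeff_coboundary\<close>).

  That the obstruction is a cochain at all is checked summand by summand: each is a composition of
  multilinear equivariant maps.
\<close>

unbundle fps_syntax

section \<open>Maps of power series that commute with multiplication by t\<close>

text \<open>
  The series have coefficients in an abelian group without a product, so multiplication by the
  variable cannot be written as a product of power series.
\<close>

definition t_times :: "'a::zero fps \<Rightarrow> 'a fps" where
  "t_times f = Abs_fps (\<lambda>r. case r of 0 \<Rightarrow> 0 | Suc q \<Rightarrow> f $ q)"

lemma t_times_nth [simp]: "t_times f $ 0 = 0" "t_times f $ Suc r = f $ r"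
  by (simp_all add: t_times_def)

lemma fps_const_plus_t_times: "fps_const (f $ 0) + t_times (fps_shift 1 f) = f"
  for f :: "'a::ab_group_add fps"
proof (rule fps_ext)
  fix r show "(fps_const (f $ 0) + t_times (fps_shift 1 f)) $ r = f $ r"
    by (cases r) simp_all
qed

locale t_linear = additive T for T :: "'a::ab_group_add fps \<Rightarrow> 'b::ab_group_add fps" +
  assumes t_times: "T (t_times f) = t_times (T f)"
begin

text \<open>
  Such a map is determined by its values on constants, because a series is its constant term plus
  \<open>t\<close> times its shift. In the two lemmas that follow the expansion, at most one of
  its summands is nonzero.
\<close>

lemma nth_expansion: "T f $ r = (\<Sum>j\<le>r. T (fps_const (f $ j)) $ (r - j))"
proof (induction r arbitrary: f)
  have split: "T f = T (fps_const (f $ 0)) + t_times (T (fps_shift 1 f))" for f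
    by (metis add t_times fps_const_plus_t_times)
  {
    case 0
    show ?case by (subst split) simp
  next
    case (Suc r)
    have "T f $ Suc r = T (fps_const (f $ 0)) $ Suc r + T (fps_shift 1 f) $ r"
      by (subst split) simp
    also have "\<dots> = (\<Sum>j\<le>Suc r. T (fps_const (f $ j)) $ (Suc r - j))"
      by (subst Suc.IH, subst sum.atMost_Suc_shift) simp
    finally show ?case .
  }
qed

lemma nth_Suc_of_vanishing_argument:
  assumes "\<And>r. r \<le> n \<Longrightarrow> h $ r = 0"
  shows "T h $ Suc n = T (fps_const (h $ Suc n)) $ 0"
  by (subst nth_expansion) (simp add: assms zero)

lemma vanishing_if_vanishing_on_constants:
  assumes "\<And>a r. r \<le> n \<Longrightarrow> T (fps_const a) $ r = 0"
  shows "r \<le> n \<Longrightarrow> T f $ r = 0"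
    and "T f $ Suc n = T (fps_const (f $ 0)) $ Suc n"
proof -
  show "r \<le> n \<Longrightarrow> T f $ r = 0"
    by (subst nth_expansion) (auto intro!: sum.neutral assms)
  have "(\<Sum>j\<le>n. T (fps_const (f $ Suc j)) $ (n - j)) = 0"
    by (auto intro!: sum.neutral assms)
  then show "T f $ Suc n = T (fps_const (f $ 0)) $ Suc n"
    by (subst nth_expansion, subst sum.atMost_Suc_shift) simp
qed

end

lemma t_linear_ident: "t_linear (\<lambda>x. x)"
  by unfold_locales simp_all

lemma t_linear_compose: "t_linear S \<Longrightarrow> t_linear T \<Longrightarrow> t_linear (\<lambda>x. S (T x))"
  by (simp add: t_linear_def t_linear_axioms_def additive_def)

lemma t_linear_diff:
  assumes "t_linear S" "t_linear T"
  shows "t_linear (\<lambda>x. S x - T x)"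
proof -
  have *: "t_times f - t_times g = t_times (f - g)" for f g :: "'b fps"
    by (rule fps_ext) (simp add: t_times_def split: nat.split)
  show ?thesis
    using assms by (simp add: t_linear_def t_linear_axioms_def additive_def *)
qed

text \<open>
  An error term that starts in degree \<open>n + 1\<close> on constants does so on all series, and its leading
  coefficient sees only the constant terms of its arguments. The three arguments are freed from
  being constant one after the other.
\<close>

lemma trilinear_leading_coefficient:
  assumes "\<And>g h. t_linear (\<lambda>f. S f g h)" "\<And>f h. t_linear (\<lambda>g. S f g h)" "\<And>f g. t_linear (S f g)"
    and vanish: "\<And>a b c r. r \<le> n \<Longrightarrow> S (fps_const a) (fps_const b) (fps_const c) $ r = 0"
  shows "S f g h $ Suc n
         = S (fps_const (f $ 0)) (fps_const (g $ 0)) (fps_const (h $ 0)) $ Suc n"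
proof -
  have 1: "S (fps_const a) (fps_const b) h $ r = 0" if "r \<le> n" for a b h r
    by (rule t_linear.vanishing_if_vanishing_on_constants(1)[OF assms(3) vanish that])
  have 2: "S (fps_const a) g h $ r = 0" if "r \<le> n" for a g h r
    by (rule t_linear.vanishing_if_vanishing_on_constants(1)[OF assms(2) 1 that])
  show "S f g h $ Suc n
         = S (fps_const (f $ 0)) (fps_const (g $ 0)) (fps_const (h $ 0)) $ Suc n"
    using t_linear.vanishing_if_vanishing_on_constants(2)[OF assms(1) 2, of n f g h]
      t_linear.vanishing_if_vanishing_on_constants(2)[OF assms(2) 1, of n "f $ 0" g h]
      t_linear.vanishing_if_vanishing_on_constants(2)[OF assms(3) vanish, of n "f $ 0" "g $ 0" h]
    by simp
qed

section \<open>Power series of maps and of products\<close>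

text \<open>
  For a sequence \<open>L\<close> of additive maps, \<open>lift1 L\<close> is the map \<open>\<Sum>i. L i t^i\<close> extended to power series.
  For a sequence \<open>M\<close> of biadditive maps, the series \<open>\<Sum>i. M i (\<cdot>) y t^i\<close> applied to \<open>f\<close> has as its
  coefficients functions of \<open>y\<close>; so \<open>lift2 M f\<close> is again the extension of a sequence of additive
  maps, and the lemmas on \<open>lift1\<close> can be used twice.
\<close>

definition lift1 :: "(nat \<Rightarrow> 'a \<Rightarrow> 'b::ab_group_add) \<Rightarrow> 'a::ab_group_add fps \<Rightarrow> 'b fps" where
  "lift1 L f = Abs_fps (\<lambda>r. \<Sum>i\<le>r. L i (f $ (r - i)))"

definition lift2 :: "(nat \<Rightarrow> 'a \<Rightarrow> 'b \<Rightarrow> 'c::ab_group_add) \<Rightarrow>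
    'a::ab_group_add fps \<Rightarrow> 'b::ab_group_add fps \<Rightarrow> 'c fps" where
  "lift2 M f g = lift1 (\<lambda>r y. lift1 (\<lambda>i x. M i x y) f $ r) g"

definition biadditive :: "('a::ab_group_add \<Rightarrow> 'b::ab_group_add \<Rightarrow> 'c::ab_group_add) \<Rightarrow> bool" where
  "biadditive m \<longleftrightarrow> (\<forall>x. additive (m x)) \<and> (\<forall>y. additive (\<lambda>x. m x y))"

lemma biadditive_left: "biadditive m \<Longrightarrow> additive (\<lambda>x. m x y)"
  and biadditive_right: "biadditive m \<Longrightarrow> additive (m x)"
  by (simp_all add: biadditive_def)

lemma t_linear_lift1:
  assumes "\<And>i. additive (L i)"
  shows "t_linear (lift1 L)"
proof
  fix f g :: "'a fps"
  show "lift1 L (f + g) = lift1 L f + lift1 L g"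
    by (rule fps_ext) (simp add: lift1_def additive.add[OF assms] sum.distrib)
  show "lift1 L (t_times f) = t_times (lift1 L f)"
  proof (rule fps_ext)
    fix r show "lift1 L (t_times f) $ r = t_times (lift1 L f) $ r"
      by (cases r) (simp_all add: lift1_def additive.zero[OF assms] Suc_diff_le)
  qed
qed

lemma lift1_const:
  assumes "\<And>i. additive (L i)"
  shows "lift1 L (fps_const a) $ r = L r a"
  by (simp add: lift1_def if_distrib additive.zero[OF assms] cong: if_cong)

lemma additive_lift1_nth:
  assumes "\<And>i x. additive (\<lambda>y. M i x y)"
  shows "additive (\<lambda>y. lift1 (\<lambda>i x. M i x y) f $ r)"
  by unfold_locales (simp add: lift1_def additive.add[OF assms] sum.distrib)

lemma t_linear_lift2_right:
  assumes "\<And>i. biadditive (M i)" "t_linear T"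
  shows "t_linear (\<lambda>x. lift2 M f (T x))"
  unfolding lift2_def
  by (rule t_linear_compose[OF t_linear_lift1 assms(2)])
     (rule additive_lift1_nth, rule biadditive_right[OF assms(1)])

lemma t_linear_lift2_left:
  assumes "\<And>i. biadditive (M i)" "t_linear T"
  shows "t_linear (\<lambda>x. lift2 M (T x) g)"
proof (rule t_linear_compose[OF _ assms(2)])
  have T: "t_linear (lift1 (\<lambda>i x. M i x y))" for y
    by (rule t_linear_lift1) (rule biadditive_left[OF assms(1)])
  note inner = additive.add[OF t_linear.axioms(1)[OF T]] t_linear.t_times[OF T]
  show "t_linear (\<lambda>f. lift2 M f g)"
  proof
    fix f h
    show "lift2 M (f + h) g = lift2 M f g + lift2 M h g"
      unfolding lift2_def inner
      by (rule fps_ext) (simp add: lift1_def[of _ g] sum.distrib)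
    show "lift2 M (t_times f) g = t_times (lift2 M f g)"
    proof (rule fps_ext)
      fix r show "lift2 M (t_times f) g $ r = t_times (lift2 M f g) $ r"
        unfolding lift2_def inner
        by (cases r) (simp_all add: lift1_def[of _ g] sum.atMost_Suc_shift del: sum.atMost_Suc)
    qed
  qed
qed

lemma lift2_const_right:
  assumes "\<And>i. biadditive (M i)"
  shows "lift2 M f (fps_const b) = lift1 (\<lambda>i x. M i x b) f"
  unfolding lift2_def
  by (rule fps_ext, subst lift1_const)
     (rule additive_lift1_nth, rule biadditive_right[OF assms], rule refl)

lemma lift2_const_left:
  assumes "\<And>i. biadditive (M i)"
  shows "lift2 M (fps_const a) g = lift1 (\<lambda>i. M i a) g"
  unfolding lift2_def
  by (subst lift1_const) (rule biadditive_left[OF assms], rule refl)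

lemma lift2_nth_0: "lift2 M f g $ 0 = M 0 (f $ 0) (g $ 0)"
  by (simp add: lift2_def lift1_def)

lemma lift1_nth_0: "lift1 L f $ 0 = L 0 (f $ 0)"
  by (simp add: lift1_def)

lemma lift2_const:
  assumes "\<And>i. biadditive (M i)"
  shows "lift2 M (fps_const a) (fps_const b) $ r = M r a b"
  unfolding lift2_const_left[OF assms] by (rule lift1_const) (rule biadditive_right[OF assms])

section \<open>The two universal identities\<close>

definition associator :: "('a \<Rightarrow> 'a \<Rightarrow> 'a::ab_group_add) \<Rightarrow> 'a \<Rightarrow> 'a \<Rightarrow> 'a \<Rightarrow> 'a" where
  "associator m a b c = m (m a b) c - m a (m b c)"

definition morphism_defect ::
  "('a \<Rightarrow> 'a \<Rightarrow> 'a) \<Rightarrow> ('b \<Rightarrow> 'b \<Rightarrow> 'b::ab_group_add) \<Rightarrow> ('a \<Rightarrow> 'b) \<Rightarrow> 'a \<Rightarrow> 'a \<Rightarrow> 'b" where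
  "morphism_defect m n f a b = n (f a) (f b) - f (m a b)"

text \<open>
  Each of the five ways to bracket \<open>a b c d\<close> occurs in exactly two of the five terms, with opposite
  signs, so additivity of the outer products suffices.
\<close>

lemma associator_cocycle:
  assumes "biadditive m"
  shows "m a (associator m b c d) - associator m (m a b) c d + associator m a (m b c) d
         - associator m a b (m c d) + m (associator m a b c) d = 0"
  by (simp add: associator_def additive.diff[OF biadditive_left[OF assms]]
      additive.diff[OF biadditive_right[OF assms]])

text \<open>
  For each of the two bracketings of \<open>a b c\<close>, pass \<open>f\<close> through one product at a time: from
  \<open>f (m (m a b) c)\<close> over \<open>n (f (m a b)) (f c)\<close> to \<open>n (n (f a) (f b)) (f c)\<close>, and similarly for the
  other one. Every step costs one defect; the right-hand side is the difference of the two totals.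
\<close>

lemma morphism_defect_coboundary:
  assumes "biadditive n" "additive f"
  shows "f (associator m a b c) - associator n (f a) (f b) (f c)
         = n (f a) (morphism_defect m n f b c) - morphism_defect m n f (m a b) c
           + morphism_defect m n f a (m b c) - n (morphism_defect m n f a b) (f c)"
  by (simp add: associator_def morphism_defect_def additive.diff[OF assms(2)]
      additive.diff[OF biadditive_left[OF assms(1)]] additive.diff[OF biadditive_right[OF assms(1)]])

lemma biadditive_lift2:
  assumes "\<And>i. biadditive (M i)"
  shows "biadditive (lift2 M)"
  unfolding biadditive_def
  using t_linear_lift2_left[OF assms t_linear_ident] t_linear_lift2_right[OF assms t_linear_ident]
  by (simp add: t_linear_def)

lemma t_linear_associator:
  assumes "\<And>i. biadditive (M i)"
  shows "t_linear (\<lambda>f. associator (lift2 M) f g h)" "t_linear (\<lambda>g. associator (lift2 M) f g h)"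
    "t_linear (\<lambda>h. associator (lift2 M) f g h)"
  unfolding associator_def
  by (intro t_linear_diff t_linear_lift2_left t_linear_lift2_right t_linear_ident assms)+

lemma t_linear_morphism_defect:
  assumes "\<And>i. biadditive (M i)" "\<And>i. biadditive (N i)" "\<And>i. additive (L i)"
  shows "t_linear (\<lambda>f. morphism_defect (lift2 M) (lift2 N) (lift1 L) f g)"
    "t_linear (\<lambda>g. morphism_defect (lift2 M) (lift2 N) (lift1 L) f g)"
  unfolding morphism_defect_def
  by (intro t_linear_diff t_linear_lift2_left t_linear_lift2_right t_linear_ident t_linear_lift1
      t_linear_compose[of "lift1 L"] assms)+

section \<open>The identities in the first degree with an error\<close>

abbreviation (input) associator_coeff where
  "associator_coeff M r a b c \<equiv> associator (lift2 M) (fps_const a) (fps_const b) (fps_const c) $ r"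

abbreviation (input) defect_coeff where
  "defect_coeff M N L r a b \<equiv>
     morphism_defect (lift2 M) (lift2 N) (lift1 L) (fps_const a) (fps_const b) $ r"

text \<open>
  The coefficient of degree \<open>n + 1\<close> of \<open>associator_cocycle\<close> for the product \<open>lift2 M\<close>. Since the
  associator vanishes up to degree \<open>n\<close>, every other factor enters with its constant term.
\<close>

lemma associator_coeff_cocycle:
  assumes M: "\<And>i. biadditive (M i)"
    and assoc: "\<And>r a b c. r \<le> n \<Longrightarrow> associator_coeff M r a b c = 0"
  shows "M 0 a (associator_coeff M (Suc n) b c d)
         - associator_coeff M (Suc n) (M 0 a b) c d
         + associator_coeff M (Suc n) a (M 0 b c) d
         - associator_coeff M (Suc n) a b (M 0 c d)
         + M 0 (associator_coeff M (Suc n) a b c) d = 0"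
proof -
  let ?m = "lift2 M" and ?F = "associator (lift2 M)"
  let ?a = "fps_const a" and ?b = "fps_const b" and ?c = "fps_const c" and ?d = "fps_const d"
  note F = trilinear_leading_coefficient[of ?F, OF t_linear_associator[OF M] assoc]
  note outer = t_linear.nth_Suc_of_vanishing_argument[OF t_linear_lift2_left[OF M t_linear_ident] assoc]
    t_linear.nth_Suc_of_vanishing_argument[OF t_linear_lift2_right[OF M t_linear_ident] assoc]
  have "(?m ?a (?F ?b ?c ?d) - ?F (?m ?a ?b) ?c ?d + ?F ?a (?m ?b ?c) ?d
         - ?F ?a ?b (?m ?c ?d) + ?m (?F ?a ?b ?c) ?d) $ Suc n = 0"
    by (simp add: associator_cocycle[OF biadditive_lift2[OF M]])
  then show ?thesis
    by (simp add: outer F[where f = "?m ?a ?b"] F[where g = "?m ?b ?c"] F[where h = "?m ?c ?d"] lift2_nth_0)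
qed

text \<open>
  The coefficient of degree \<open>n + 1\<close> of \<open>morphism_defect_coboundary\<close>. The associator of \<open>N\<close> is taken at
  the series that \<open>lift1 L\<close> assigns to \<open>a\<close>, \<open>b\<close>, \<open>c\<close>; its leading coefficient depends
  only on their constant terms \<open>L 0 a\<close>, \<open>L 0 b\<close>, \<open>L 0 c\<close>.
\<close>

lemma defect_coeff_coboundary:
  assumes M: "\<And>i. biadditive (M i)" and N: "\<And>i. biadditive (N i)" and L: "\<And>i. additive (L i)"
    and assocM: "\<And>r a b c. r \<le> n \<Longrightarrow> associator_coeff M r a b c = 0"
    and assocN: "\<And>r a b c. r \<le> n \<Longrightarrow> associator_coeff N r a b c = 0"
    and mor: "\<And>r a b. r \<le> n \<Longrightarrow> defect_coeff M N L r a b = 0"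
  shows "L 0 (associator_coeff M (Suc n) a b c)
         - associator_coeff N (Suc n) (L 0 a) (L 0 b) (L 0 c)
         = N 0 (L 0 a) (defect_coeff M N L (Suc n) b c)
           - defect_coeff M N L (Suc n) (M 0 a b) c
           + defect_coeff M N L (Suc n) a (M 0 b c)
           - N 0 (defect_coeff M N L (Suc n) a b) (L 0 c)"
proof -
  let ?m = "lift2 M" and ?n = "lift2 N" and ?f = "lift1 L"
  let ?F = "associator (lift2 M)" and ?F' = "associator (lift2 N)"
    and ?H = "morphism_defect (lift2 M) (lift2 N) (lift1 L)"
  let ?a = "fps_const a" and ?b = "fps_const b" and ?c = "fps_const c"
  note F = trilinear_leading_coefficient[of ?F', OF t_linear_associator[OF N] assocN]
  note H = t_linear.vanishing_if_vanishing_on_constants(2)[OF t_linear_morphism_defect(1)[OF M N L] mor]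
    t_linear.vanishing_if_vanishing_on_constants(2)[OF t_linear_morphism_defect(2)[OF M N L] mor]
  note outer = t_linear.nth_Suc_of_vanishing_argument[OF t_linear_lift2_left[OF N t_linear_ident] mor]
    t_linear.nth_Suc_of_vanishing_argument[OF t_linear_lift2_right[OF N t_linear_ident] mor]
    t_linear.nth_Suc_of_vanishing_argument[OF t_linear_lift1[OF L] assocM]
  have "(?f (?F ?a ?b ?c) - ?F' (?f ?a) (?f ?b) (?f ?c)) $ Suc n
      = (?n (?f ?a) (?H ?b ?c) - ?H (?m ?a ?b) ?c + ?H ?a (?m ?b ?c) - ?n (?H ?a ?b) (?f ?c)) $ Suc n"
    using morphism_defect_coboundary[OF biadditive_lift2[OF N] t_linear.axioms(1)[OF t_linear_lift1[OF L]],
        where m = ?m and a = ?a and b = ?b and c = ?c] by simp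
  then show ?thesis
    by (simp add: outer F[where f = "?f ?a"] H(1)[where f = "?m ?a ?b"] H(2)[where f = "?m ?b ?c"]
        lift2_nth_0 lift1_nth_0)
qed

section \<open>The error coefficients as sums over indices\<close>

lemma sum_antidiagonal: "(\<Sum>(i, j)\<in>{(i, j). i + j = r}. f i j) = (\<Sum>i\<le>r. f i (r - i))"
  for f :: "nat \<Rightarrow> nat \<Rightarrow> 'a::comm_monoid_add"
  by (rule sum.reindex_bij_witness[of _ "\<lambda>i. (i, r - i)" fst]) auto

lemma sum_triples:
  "(\<Sum>(i, j, k)\<in>{(i, j, k). i + j + k = r}. f i j k) = (\<Sum>s\<le>r. \<Sum>i\<le>s. f i (s - i) (r - s))"
  for f :: "nat \<Rightarrow> nat \<Rightarrow> nat \<Rightarrow> 'a::comm_monoid_add"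
  unfolding sum.Sigma[OF finite_atMost ballI[OF finite_atMost]]
  by (rule sum.reindex_bij_witness[of _ "\<lambda>(s, i). (i, s - i, r - s)" "\<lambda>(i, j, k). (i + j, i)"]) auto

lemma finite_antidiagonal: "finite {(i, j). i + j = (r::nat)}"
  by (rule finite_subset[of _ "{..r} \<times> {..r}"]) auto

lemma finite_triples: "finite {(i, j, k). i + j + k = (r::nat)}"
  by (rule finite_subset[of _ "{..r} \<times> {..r} \<times> {..r}"]) auto

lemma associator_coeff_eq:
  assumes M: "\<And>i. biadditive (M i)"
  shows "associator_coeff M r a b c
         = (\<Sum>(i, j)\<in>{(i, j). i + j = r}. M i (M j a b) c)
           - (\<Sum>(i, j)\<in>{(i, j). i + j = r}. M i a (M j b c))"
  unfolding sum_antidiagonal associator_def lift2_const_left[OF M, where g = "lift2 _ _ _"]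
    lift2_const_right[OF M, where f = "lift2 _ _ _"]
  by (simp add: lift1_def[of _ "lift2 _ _ _"] lift2_const[OF M])

lemma defect_coeff_eq:
  assumes M: "\<And>i. biadditive (M i)" and L: "\<And>i. additive (L i)"
  shows "defect_coeff M N L r a b
         = (\<Sum>(i, j, k)\<in>{(i, j, k). i + j + k = r}. N i (L j a) (L k b))
           - (\<Sum>(i, j)\<in>{(i, j). i + j = r}. L i (M j a b))"
  unfolding sum_antidiagonal sum_triples morphism_defect_def
  by (simp add: lift2_def[of N] lift1_def[of _ "lift1 _ _"] lift1_def[of _ "lift2 _ _ _"]
      lift2_const[OF M] lift1_const[OF L])

section \<open>The obstruction as the leading error of the truncated deformation\<close>

text \<open>
  The coefficients of an order \<open>n\<close> deformation with index above \<open>n\<close> are arbitrary. Replacing them by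
  zero (the argument \<open>z\<close>) leaves the deformation equations up to degree \<open>n\<close> as they are, and turns the
  equations of degree \<open>n + 1\<close> into the vanishing of the obstruction.
\<close>

definition truncated :: "nat \<Rightarrow> 'b \<Rightarrow> (nat \<Rightarrow> 'b) \<Rightarrow> nat \<Rightarrow> 'b" where
  "truncated n z M i = (if i \<le> n then M i else z)"

abbreviation (input) trunc_op :: "nat \<Rightarrow> (nat \<Rightarrow> 'a \<Rightarrow> 'b \<Rightarrow> 'c::zero) \<Rightarrow> nat \<Rightarrow> 'a \<Rightarrow> 'b \<Rightarrow> 'c" where
  "trunc_op n \<equiv> truncated n (\<lambda>_ _. 0)"

abbreviation (input) trunc_map :: "nat \<Rightarrow> (nat \<Rightarrow> 'a \<Rightarrow> 'b::zero) \<Rightarrow> nat \<Rightarrow> 'a \<Rightarrow> 'b" where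
  "trunc_map n \<equiv> truncated n (\<lambda>_. 0)"

lemma biadditive_trunc_op:
  assumes "\<And>i. i \<le> n \<Longrightarrow> biadditive (M i)"
  shows "biadditive (trunc_op n M i)"
  using assms by (simp add: truncated_def biadditive_def additive_def)

lemma additive_trunc_map:
  assumes "\<And>i. i \<le> n \<Longrightarrow> additive (L i)"
  shows "additive (trunc_map n L i)"
  using assms by (simp add: truncated_def additive_def)

lemma associator_coeff_trunc_low:
  assumes M: "\<And>i. i \<le> n \<Longrightarrow> biadditive (M i)" and "r \<le> n"
  shows "associator_coeff (trunc_op n M) r a b c
         = (\<Sum>(i, j)\<in>{(i, j). i + j = r}. M i (M j a b) c)
           - (\<Sum>(i, j)\<in>{(i, j). i + j = r}. M i a (M j b c))"
proof -
  have bi: "biadditive (trunc_op n M i)" for i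
    using M by (rule biadditive_trunc_op)
  show ?thesis
    unfolding associator_coeff_eq[OF bi] using \<open>r \<le> n\<close>
    by (auto simp: truncated_def intro!: arg_cong2[where f = minus] sum.cong)
qed

lemma defect_coeff_trunc_low:
  assumes M: "\<And>i. i \<le> n \<Longrightarrow> biadditive (M i)" and L: "\<And>i. i \<le> n \<Longrightarrow> additive (L i)" and "r \<le> n"
  shows "defect_coeff (trunc_op n M) (trunc_op n N) (trunc_map n L) r a b
         = (\<Sum>(i, j, k)\<in>{(i, j, k). i + j + k = r}. N i (L j a) (L k b))
           - (\<Sum>(i, j)\<in>{(i, j). i + j = r}. L i (M j a b))"
proof -
  have bi: "biadditive (trunc_op n M i)" for i
    using M by (rule biadditive_trunc_op)
  have ad: "additive (trunc_map n L i)" for i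
    using L by (rule additive_trunc_map)
  show ?thesis
    unfolding defect_coeff_eq[OF bi ad] using \<open>r \<le> n\<close>
    by (auto simp: truncated_def intro!: arg_cong2[where f = minus] sum.cong)
qed

text \<open>
  In degree \<open>n + 1\<close> a pair with a zero index has \<open>n + 1\<close> as its other index, where the truncated
  sequence is zero. This is why the obstruction sums over positive indices only.
\<close>

lemma associator_obstruction_eq_coeff:
  assumes M: "\<And>i. i \<le> n \<Longrightarrow> biadditive (M i)"
  shows "associator_obstruction n M [a, b, c] = associator_coeff (trunc_op n M) (Suc n) a b c"
proof -
  let ?M = "trunc_op n M"
  let ?I = "{(i, j). i + j = Suc n \<and> 0 < i \<and> 0 < j}"
  have bi: "biadditive (?M i)" for i
    using M by (rule biadditive_trunc_op)
  have support: "0 < i \<and> 0 < j"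
    if "?M i (?M j a b) c \<noteq> ?M i a (?M j b c)" "i + j = Suc n" for i j
    using that additive.zero[OF biadditive_left[OF M]] additive.zero[OF biadditive_right[OF M]]
    by (cases "i = 0 \<or> j = 0") (auto simp: truncated_def)
  have "associator_coeff ?M (Suc n) a b c
      = (\<Sum>(i, j)\<in>{(i, j). i + j = Suc n}. ?M i (?M j a b) c - ?M i a (?M j b c))"
    by (simp add: associator_coeff_eq[OF bi] sum_subtractf split_def)
  also have "\<dots> = (\<Sum>(i, j)\<in>?I. ?M i (?M j a b) c - ?M i a (?M j b c))"
    by (rule sum.mono_neutral_right[OF finite_antidiagonal])
       (auto dest: support)
  also have "\<dots> = (\<Sum>(i, j)\<in>?I. M i (M j a b) c - M i a (M j b c))"
    by (rule sum.cong) (auto simp: truncated_def)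
  finally show ?thesis by (simp add: associator_obstruction_def)
qed

text \<open>
  Likewise a triple of sum \<open>n + 1\<close> with fewer than two positive entries has \<open>n + 1\<close> as an entry.
\<close>

lemma morphism_obstruction_eq_coeff:
  assumes M: "\<And>i. i \<le> n \<Longrightarrow> biadditive (M i)" and N: "\<And>i. i \<le> n \<Longrightarrow> biadditive (N i)"
    and L: "\<And>i. i \<le> n \<Longrightarrow> additive (L i)"
  shows "morphism_obstruction n M N L [a, b]
         = defect_coeff (trunc_op n M) (trunc_op n N) (trunc_map n L) (Suc n) a b"
proof -
  let ?M = "trunc_op n M" and ?N = "trunc_op n N" and ?L = "trunc_map n L"
  let ?I = "{(i, j). i + j = Suc n \<and> 0 < i \<and> 0 < j}"
  let ?J = "{(i, j, k). i + j + k = Suc n \<and> (0 < i \<and> 0 < j \<or> 0 < i \<and> 0 < k \<or> 0 < j \<and> 0 < k)}"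
  have bi: "biadditive (?M i)" for i
    using M by (rule biadditive_trunc_op)
  have ad: "additive (?L i)" for i
    using L by (rule additive_trunc_map)
  have supportN: "0 < i \<and> 0 < j \<or> 0 < i \<and> 0 < k \<or> 0 < j \<and> 0 < k"
    if "?N i (?L j a) (?L k b) \<noteq> 0" "i + j + k = Suc n" for i j k
  proof (rule ccontr)
    assume "\<not> ?thesis"
    with that(2) have "i = Suc n \<or> j = Suc n \<or> k = Suc n" by auto
    with that(1) show False
      using additive.zero[OF biadditive_left[OF N]] additive.zero[OF biadditive_right[OF N]]
      by (auto simp: truncated_def split: if_splits)
  qed
  have supportL: "0 < i \<and> 0 < j" if "?L i (?M j a b) \<noteq> 0" "i + j = Suc n" for i j
    using that additive.zero[OF L] by (cases "i = 0 \<or> j = 0") (auto simp: truncated_def)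
  have "(\<Sum>(i, j, k)\<in>{(i, j, k). i + j + k = Suc n}. ?N i (?L j a) (?L k b))
      = (\<Sum>(i, j, k)\<in>?J. ?N i (?L j a) (?L k b))"
    by (rule sum.mono_neutral_right[OF finite_triples])
       (auto dest: supportN)
  also have "\<dots> = (\<Sum>(i, j, k)\<in>?J. N i (L j a) (L k b))"
    by (rule sum.cong) (auto simp: truncated_def)
  moreover have "(\<Sum>(i, j)\<in>{(i, j). i + j = Suc n}. ?L i (?M j a b)) = (\<Sum>(i, j)\<in>?I. ?L i (?M j a b))"
    by (rule sum.mono_neutral_right[OF finite_antidiagonal])
       (auto dest: supportL)
  moreover have "\<dots> = (\<Sum>(i, j)\<in>?I. L i (M j a b))"
    by (rule sum.cong) (auto simp: truncated_def)
  ultimately show ?thesis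
    by (simp add: morphism_obstruction_def defect_coeff_eq[OF bi ad])
qed

section \<open>The obstruction is an equivariant cochain\<close>

lemma linear_imp_additive: "Vector_Spaces.linear s s' f \<Longrightarrow> additive f"
  by (simp add: Vector_Spaces.linear_iff additive_def)

lemma bilinear_op_imp_biadditive: "bilinear_op s m \<Longrightarrow> biadditive m"
  unfolding bilinear_op_def biadditive_def using linear_imp_additive by blast

lemma linear_sum_fun:
  assumes "vector_space s" "vector_space s'" "\<And>a. a \<in> S \<Longrightarrow> Vector_Spaces.linear s s' (f a)"
  shows "Vector_Spaces.linear s s' (\<lambda>x. \<Sum>a\<in>S. f a x)"
  using assms vector_space_pair.linear_compose_sum[of s s' S f] by (simp add: vector_space_pair_def)

lemma linear_diff_fun:
  assumes "Vector_Spaces.linear s s' f" "Vector_Spaces.linear s s' g"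
  shows "Vector_Spaces.linear s s' (\<lambda>x. f x - g x)"
  using assms vector_space_pair.linear_compose_sub[of s s' f g]
  by (simp add: vector_space_pair_def Vector_Spaces.linear_iff)

lemma linear_comp_fun:
  assumes "Vector_Spaces.linear s' s'' g" "Vector_Spaces.linear s s' f"
  shows "Vector_Spaces.linear s s'' (\<lambda>x. g (f x))"
  using assms by (simp add: Vector_Spaces.linear_iff)

lemma bilinear_opD:
  assumes "bilinear_op s m"
  shows "Vector_Spaces.linear s s (m x)" "Vector_Spaces.linear s s (\<lambda>x. m x y)"
  using assms by (simp_all add: bilinear_op_def)

lemma length_3_conv: "length xs = 3 \<longleftrightarrow> (\<exists>a b c. xs = [a, b, c])"
  by (auto simp: numeral_3_eq_3 length_Suc_conv)

lemma length_4_conv: "length xs = 4 \<longleftrightarrow> (\<exists>a b c d. xs = [a, b, c, d])"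
  by (auto simp: eval_nat_numeral length_Suc_conv)

lemma length_2_conv: "length xs = 2 \<longleftrightarrow> (\<exists>a b. xs = [a, b])"
  by (auto simp: numeral_2_eq_2 length_Suc_conv)

lemma associator_obstruction_mem_cochains:
  assumes vs: "vector_space s"
    and act: "\<And>g. g \<in> carrier G \<Longrightarrow> Vector_Spaces.linear s s (act g)"
    and bil: "\<And>i. i \<le> n \<Longrightarrow> bilinear_op s (\<mu> i)"
    and equi: "\<And>i. i \<le> n \<Longrightarrow> equivariant_op G act (\<mu> i)"
  shows "associator_obstruction n \<mu> \<in> cochains G s act s act 3"
  unfolding cochains_def mem_Collect_eq
proof (intro conjI allI impI ballI)
  let ?I = "{(i, j). i + j = n + 1 \<and> 0 < i \<and> 0 < j}"
  (* Indices are projections of p so that each sum has the form required by linear_sum_fun. *)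
  let ?t = "\<lambda>a b c p. \<mu> (fst p) (\<mu> (snd p) a b) c - \<mu> (fst p) a (\<mu> (snd p) b c)"
  have O: "associator_obstruction n \<mu> [a, b, c] = (\<Sum>p\<in>?I. ?t a b c p)" for a b c
    by (simp add: associator_obstruction_def split_def)
  show "associator_obstruction n \<mu> xs = 0" if "length xs \<noteq> 3" for xs
    using that by (auto simp: associator_obstruction_def split: list.split)
  show "Vector_Spaces.linear s s (\<lambda>x. associator_obstruction n \<mu> (xs[i := x]))"
    if "length xs = 3" "i < 3" for xs i
  proof -
    obtain a b c where xs: "xs = [a, b, c]" using \<open>length xs = 3\<close> by (auto simp: length_3_conv)
    note slots = bilinear_opD[OF bil]
    note nested = linear_comp_fun[OF slots(1) slots(1)] linear_comp_fun[OF slots(1) slots(2)]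
      linear_comp_fun[OF slots(2) slots(1)] linear_comp_fun[OF slots(2) slots(2)]
    have "i = 0 \<or> i = 1 \<or> i = 2" using \<open>i < 3\<close> by auto
    then show ?thesis
      by (elim disjE; simp add: xs O numeral_2_eq_2;
          intro linear_sum_fun vs linear_diff_fun;
          auto intro!: nested slots)
  qed
  show "associator_obstruction n \<mu> (map (act g) xs) = act g (associator_obstruction n \<mu> xs)"
    if g: "g \<in> carrier G" and len: "length xs = 3" for g xs
  proof -
    obtain a b c where xs: "xs = [a, b, c]" using len by (auto simp: length_3_conv)
    have eq: "\<mu> i (act g x) (act g y) = act g (\<mu> i x y)" if "i \<le> n" for i x y
      using equi[OF that] g by (simp add: equivariant_op_def)
    have "?t (act g a) (act g b) (act g c) p = act g (?t a b c p)" if "p \<in> ?I" for p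
    proof -
      have "fst p \<le> n" "snd p \<le> n" using that by auto
      then show ?thesis by (simp add: eq additive.diff[OF linear_imp_additive[OF act[OF g]]])
    qed
    then show ?thesis
      by (simp add: xs O additive.sum[OF linear_imp_additive[OF act[OF g]]])
  qed
qed

lemma morphism_obstruction_mem_cochains:
  assumes vsA: "vector_space sA" and vsB: "vector_space sB"
    and actB: "\<And>g. g \<in> carrier G \<Longrightarrow> Vector_Spaces.linear sB sB (actB g)"
    and bil: "\<And>i. i \<le> n \<Longrightarrow> bilinear_op sA (\<mu> i)" "\<And>i. i \<le> n \<Longrightarrow> bilinear_op sB (\<nu> i)"
    and lin: "\<And>i. i \<le> n \<Longrightarrow> Vector_Spaces.linear sA sB (\<phi>t i)"
    and equi: "\<And>i. i \<le> n \<Longrightarrow> equivariant_op G actA (\<mu> i)"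
      "\<And>i. i \<le> n \<Longrightarrow> equivariant_op G actB (\<nu> i)"
      "\<And>i. i \<le> n \<Longrightarrow> equivariant_map G actA actB (\<phi>t i)"
  shows "morphism_obstruction n \<mu> \<nu> \<phi>t \<in> cochains G sA actA sB actB 2"
  unfolding cochains_def mem_Collect_eq
proof (intro conjI allI impI ballI)
  let ?J = "{(i, j, k). i + j + k = n + 1 \<and> (0 < i \<and> 0 < j \<or> 0 < i \<and> 0 < k \<or> 0 < j \<and> 0 < k)}"
  let ?I = "{(i, j). i + j = n + 1 \<and> 0 < i \<and> 0 < j}"
  let ?s = "\<lambda>a b p. \<nu> (fst p) (\<phi>t (fst (snd p)) a) (\<phi>t (snd (snd p)) b)"
  let ?t = "\<lambda>a b p. \<phi>t (fst p) (\<mu> (snd p) a b)"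
  have O: "morphism_obstruction n \<mu> \<nu> \<phi>t [a, b] = (\<Sum>p\<in>?J. ?s a b p) - (\<Sum>p\<in>?I. ?t a b p)" for a b
    by (simp add: morphism_obstruction_def split_def)
  show "morphism_obstruction n \<mu> \<nu> \<phi>t xs = 0" if "length xs \<noteq> 2" for xs
    using that by (auto simp: morphism_obstruction_def split: list.split)
  show "Vector_Spaces.linear sA sB (\<lambda>x. morphism_obstruction n \<mu> \<nu> \<phi>t (xs[i := x]))"
    if "length xs = 2" "i < 2" for xs i
  proof -
    obtain a b where xs: "xs = [a, b]" using \<open>length xs = 2\<close> by (auto simp: length_2_conv)
    have "i = 0 \<or> i = 1" using \<open>i < 2\<close> by auto
    then show ?thesis
      by (elim disjE; simp add: xs O;
          intro linear_sum_fun vsA vsB linear_diff_fun;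
          auto intro!: linear_comp_fun[OF bilinear_opD(1)[OF bil(2)] lin]
            linear_comp_fun[OF bilinear_opD(2)[OF bil(2)] lin]
            linear_comp_fun[OF lin] bilinear_opD[OF bil(1)])
  qed
  show "morphism_obstruction n \<mu> \<nu> \<phi>t (map (actA g) xs) = actB g (morphism_obstruction n \<mu> \<nu> \<phi>t xs)"
    if g: "g \<in> carrier G" and len: "length xs = 2" for g xs
  proof -
    obtain a b where xs: "xs = [a, b]" using len by (auto simp: length_2_conv)
    note add = linear_imp_additive[OF actB[OF g]]
    have eq: "\<mu> i (actA g x) (actA g y) = actA g (\<mu> i x y)"
      "\<nu> i (actB g x') (actB g y') = actB g (\<nu> i x' y')"
      "\<phi>t i (actA g x) = actB g (\<phi>t i x)" if "i \<le> n" for i x y x' y'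
      using equi[OF that] g by (simp_all add: equivariant_op_def equivariant_map_def)
    have "?s (actA g a) (actA g b) p = actB g (?s a b p)" if "p \<in> ?J" for p
    proof -
      have "fst p \<le> n" "fst (snd p) \<le> n" "snd (snd p) \<le> n" using that by auto
      then show ?thesis by (simp add: eq)
    qed
    moreover have "?t (actA g a) (actA g b) p = actB g (?t a b p)" if "p \<in> ?I" for p
    proof -
      have "fst p \<le> n" "snd p \<le> n" using that by auto
      then show ?thesis by (simp add: eq)
    qed
    ultimately show ?thesis
      by (simp add: xs O additive.diff[OF add] additive.sum[OF add])
  qed
qed

section \<open>The cocycle condition\<close>

lemma hochschild_3:
  assumes "vector_space s"
  shows "hochschild s m m m 3 f [a, b, c, d]
         = m a (f [b, c, d]) - f [m a b, c, d] + f [a, m b c, d] - f [a, b, m c d] + m (f [a, b, c]) d"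
proof -
  interpret vector_space s by fact
  show ?thesis by (simp add: hochschild_def eval_nat_numeral)
qed

lemma hochschild_2:
  assumes "vector_space s"
  shows "hochschild s m l r 2 f [a, b, c]
         = l a (f [b, c]) - f [m a b, c] + f [a, m b c] - r (f [a, b]) c"
proof -
  interpret vector_space s by fact
  show ?thesis by (simp add: hochschild_def eval_nat_numeral)
qed

lemma hochschild_associator_obstruction:
  assumes vs: "vector_space s"
    and bil: "\<And>i. i \<le> n \<Longrightarrow> biadditive (\<mu> i)"
    and low: "\<And>r a b c. r \<le> n \<Longrightarrow> associator_coeff (trunc_op n \<mu>) r a b c = 0"
  shows "hochschild s (\<mu> 0) (\<mu> 0) (\<mu> 0) 3 (associator_obstruction n \<mu>) = (\<lambda>_. 0)"
proof
  fix xs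
  show "hochschild s (\<mu> 0) (\<mu> 0) (\<mu> 0) 3 (associator_obstruction n \<mu>) xs = 0"
  proof (cases "length xs = 4")
    case True
    then obtain a b c d where xs: "xs = [a, b, c, d]" by (auto simp: length_4_conv)
    have "trunc_op n \<mu> 0 = \<mu> 0" by (simp add: truncated_def)
    then show ?thesis
      using associator_coeff_cocycle[OF biadditive_trunc_op[OF bil] low,
        where a = a and b = b and c = c and d = d]
      by (simp add: xs hochschild_3[OF vs] associator_obstruction_eq_coeff[OF bil])
  qed (simp add: hochschild_def)
qed

theorem theorem4p1:
  fixes G :: "('g, 'z) monoid_scheme"
    and sA :: "'k::field \<Rightarrow> 'a::ab_group_add \<Rightarrow> 'a" and mA :: "'a \<Rightarrow> 'a \<Rightarrow> 'a"
    and actA :: "'g \<Rightarrow> 'a \<Rightarrow> 'a"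
    and sB :: "'k \<Rightarrow> 'b::ab_group_add \<Rightarrow> 'b" and mB :: "'b \<Rightarrow> 'b \<Rightarrow> 'b"
    and actB :: "'g \<Rightarrow> 'b \<Rightarrow> 'b"
    and \<phi> :: "'a \<Rightarrow> 'b" and n :: nat
    and \<mu> :: "nat \<Rightarrow> 'a \<Rightarrow> 'a \<Rightarrow> 'a" and \<nu> :: "nat \<Rightarrow> 'b \<Rightarrow> 'b \<Rightarrow> 'b" and \<phi>t :: "nat \<Rightarrow> 'a \<Rightarrow> 'b"
  assumes "group G" and "finite (carrier G)"
    and "equivariant_alg G sA mA actA" and "equivariant_alg G sB mB actB"
    and "equivariant_alg_morphism G sA mA actA sB mB actB \<phi>"
    and "n \<ge> 1"
    and "equivariant_deformation G sA mA actA sB mB actB \<phi> n \<mu> \<nu> \<phi>t"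
  shows "obstruction n \<mu> \<nu> \<phi>t \<in> deformation_cochains G sA actA sB actB 3 \<and>
         deformation_d sA mA sB mB \<phi> 3 (obstruction n \<mu> \<nu> \<phi>t) = (\<lambda>_. 0, \<lambda>_. 0, \<lambda>_. 0)"
proof
  interpret A: equivariant_alg G sA mA actA by fact
  interpret B: equivariant_alg G sB mB actB by fact
  note vsA = A.vector_space_axioms and vsB = B.vector_space_axioms
  note D = assms(7)[unfolded equivariant_deformation_def]
  have zero: "mA = \<mu> 0" "mB = \<nu> 0" "\<phi> = \<phi>t 0" using D by auto
  have bil: "\<And>i. i \<le> n \<Longrightarrow> bilinear_op sA (\<mu> i)" "\<And>i. i \<le> n \<Longrightarrow> bilinear_op sB (\<nu> i)"
    and lin: "\<And>i. i \<le> n \<Longrightarrow> Vector_Spaces.linear sA sB (\<phi>t i)"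
    and equi: "\<And>i. i \<le> n \<Longrightarrow> equivariant_op G actA (\<mu> i)"
      "\<And>i. i \<le> n \<Longrightarrow> equivariant_op G actB (\<nu> i)"
      "\<And>i. i \<le> n \<Longrightarrow> equivariant_map G actA actB (\<phi>t i)"
    using D by auto
  note M = bilinear_op_imp_biadditive[OF bil(1)] and N = bilinear_op_imp_biadditive[OF bil(2)]
    and L = linear_imp_additive[OF lin]
  have lowM: "associator_coeff (trunc_op n \<mu>) r a b c = 0" if "r \<le> n" for r a b c
    using D that by (simp add: associator_coeff_trunc_low[OF M that])
  have lowN: "associator_coeff (trunc_op n \<nu>) r a b c = 0" if "r \<le> n" for r a b c
    using D that by (simp add: associator_coeff_trunc_low[OF N that])
  have lowH: "defect_coeff (trunc_op n \<mu>) (trunc_op n \<nu>) (trunc_map n \<phi>t) r a b = 0"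
    if "r \<le> n" for r a b
    using D that by (simp add: defect_coeff_trunc_low[OF M L that])
  show "obstruction n \<mu> \<nu> \<phi>t \<in> deformation_cochains G sA actA sB actB 3"
    using associator_obstruction_mem_cochains[OF vsA A.act_linear bil(1) equi(1)]
      associator_obstruction_mem_cochains[OF vsB B.act_linear bil(2) equi(2)]
      morphism_obstruction_mem_cochains[OF vsA vsB B.act_linear bil lin equi]
    by (simp add: obstruction_def deformation_cochains_def)
  (* The cocycle condition subtracts the coboundary of the defect, which is the right-hand side
     of defect_coeff_coboundary with the bimodule structure of B along \<phi> written out. *)
  have third: "\<phi> (associator_obstruction n \<mu> xs) - associator_obstruction n \<nu> (map \<phi> xs)
      - hochschild sB mA (\<lambda>a b. mB (\<phi> a) b) (\<lambda>b a. mB b (\<phi> a)) 2 (morphism_obstruction n \<mu> \<nu> \<phi>t) xs = 0"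
    for xs
  proof (cases "length xs = 3")
    case True
    then obtain a b c where xs: "xs = [a, b, c]" by (auto simp: length_3_conv)
    have "trunc_op n \<mu> 0 = \<mu> 0" "trunc_op n \<nu> 0 = \<nu> 0" "trunc_map n \<phi>t 0 = \<phi>t 0"
      by (simp_all add: truncated_def)
    then show ?thesis
      using defect_coeff_coboundary[OF biadditive_trunc_op[OF M] biadditive_trunc_op[OF N]
          additive_trunc_map[OF L] lowM lowN lowH, where a = a and b = b and c = c]
      by (simp add: xs zero hochschild_2[OF vsB] associator_obstruction_eq_coeff[OF M]
          associator_obstruction_eq_coeff[OF N] morphism_obstruction_eq_coeff[OF M N L])
  next
    case False
    then have "associator_obstruction n \<mu> xs = 0" "associator_obstruction n \<nu> (map \<phi> xs) = 0"
      by (auto simp: associator_obstruction_def split: list.split)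
    with False show ?thesis by (simp add: hochschild_def zero additive.zero[OF L])
  qed
  show "deformation_d sA mA sB mB \<phi> 3 (obstruction n \<mu> \<nu> \<phi>t) = (\<lambda>_. 0, \<lambda>_. 0, \<lambda>_. 0)"
    using third hochschild_associator_obstruction[OF vsA M lowM]
      hochschild_associator_obstruction[OF vsB N lowN]
    by (simp add: obstruction_def zero)
qed

end
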